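(* Assume Data (D1)–(D7) listed in the context. For each $g=(I-PA^2P)f$ with $f \in D$, we have $$g \in D((BA)^* ) \quad\text{with}\quad (BA)^*g=-A^2Pf.$$ Assume in addition that $(PA^2P,D)$ is essentially m-dissipative (or, respectively, essentially selfadjoint) and that there exists $M_2 < \infty$ such that $$\|(BA)^*g\| \leq M_2 \,\|g\| \quad\text{for all } g=(I-PA^2P)f,\ f \in D.$$ Then $(BA(I-P),D)$ is bounded and, for some choice of $P_2\in\{P,P_S\}$, $$\|BA(I-P)f\|\le M_2\,\|(I-P_2)f\|\quad\text{for all } f\in D.$$
   Context: Data (D): (D1) $(E,\mathcal{F},\mu)$ is a probability space and $H=L^2(E,\mu)$ is the real Hilbert space with usual scalar product $(\cdot,\cdot)_H$ and norm $\|\cdot\|$. (D2) $(L,D(L))$ is a linear operator on $H$ generating a strongly continuous semigroup $(T(t))_{t\ge0}$. (D3) $D\subset D(L)$ is a dense subspace of $H$ which is a core for $(L,D(L))$. (D4) $(S,D(S))$ is a symmetric and $(A,D(A))$ a closed and antisymmetric linear operator on $H$ with $D\subset D(S)\cap D(A)$ and $L_{|D}=S-A$. (D5) $P:H\to H$ is an orthogonal projection with $P(H)\subset D(S)$, $SP=0$, $P(D)\subset D(A)$ and $AP(D)\subset D(A)$. Moreover $P_S:H\to H$, $P_Sf:=Pf+(f,1)_H$. (D6) $(Lf,1)_H=\int_E Lf\,\mathrm{d}\mu=0$ for all $f\in D$. (D7) $1\in D(L)$ and $L1=0$. $AP$ has domain $D(AP)=\{f\in H: Pf\in D(A)\}$;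 it is closed and densely defined. $B$ is the unique continuous linear extension to $H$ of the (bounded) operator $B:=(I+(AP)^*AP)^{-1}(AP)^*$ defined on $D((AP)^* )$. The operator $BA$ has domain $D(A)$. $PA^2P$ on $D$ means $f\mapsto P(A(A(Pf)))$; it is symmetric and nonpositive definite, and being essentially m-dissipative (dissipative with m-dissipative closure) amounts to $(I-PA^2P)(D)$ being dense in $H$. *)

theory Defs
  imports "HOL-Probability.Probability"
begin

definition square_integrable :: "'e measure \<Rightarrow> ('e \<Rightarrow> real) \<Rightarrow> bool" where
  "square_integrable M \<phi> \<longleftrightarrow> \<phi> \<in> borel_measurable M \<and> integrable M (\<lambda>x. (\<phi> x)\<^sup>2)"

text \<open>
  A type cannot depend on the measure \<open>M\<close>, so the real \<open>L\<^sup>2(M)\<close> is a type \<open>'h\<close> together with the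
  map \<open>cls\<close> that sends a square integrable function to its class modulo equality almost
  everywhere: every element of \<open>'h\<close> is such a class, two classes are equal iff the functions agree
  almost everywhere, and the vector space operations and the scalar product are the usual ones.
  The values of \<open>cls\<close> at functions that are not square integrable are irrelevant.
\<close>

definition is_L2 :: "'e measure \<Rightarrow> (('e \<Rightarrow> real) \<Rightarrow> 'h::real_inner) \<Rightarrow> bool" where
  "is_L2 M cls \<longleftrightarrow>
     (\<forall>h. \<exists>\<phi>. square_integrable M \<phi> \<and> cls \<phi> = h) \<and>
     (\<forall>\<phi> \<psi>. square_integrable M \<phi> \<longrightarrow> square_integrable M \<psi> \<longrightarrow>
        (cls \<phi> = cls \<psi> \<longleftrightarrow> (AE x in M. \<phi> x = \<psi> x)) \<and>
        cls (\<lambda>x. \<phi> x + \<psi> x) = cls \<phi> + cls \<psi> \<and>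
        cls \<phi> \<bullet> cls \<psi> = (\<integral>x. \<phi> x * \<psi> x \<partial>M)) \<and>
     (\<forall>c \<phi>. square_integrable M \<phi> \<longrightarrow> cls (\<lambda>x. c * \<phi> x) = c *\<^sub>R cls \<phi>)"

text \<open>
  An operator \<open>(T, D(T))\<close> is represented by its graph. Hence \<open>D(T)\<close> is \<^const>\<open>Domain\<close>, the
  closure of an operator is the topological \<^const>\<open>closure\<close> of its graph, the inverse is
  \<^const>\<open>converse\<close>, the identity is \<^const>\<open>Id\<close>, and the product \<open>T S\<close> with its natural domain
  is \<open>S O T\<close> (relational composition applies the left factor first).
\<close>

type_synonym 'h operator = "('h \<times> 'h) set"

definition linear_operator :: "'h::real_vector operator \<Rightarrow> bool" where
  "linear_operator T \<longleftrightarrow> subspace T \<and> single_valued T"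

definition app :: "'h operator \<Rightarrow> 'h \<Rightarrow> 'h"  ("_\<langle>_\<rangle>" [1000, 0] 1000) where
  "T\<langle>f\<rangle> = (THE g. (f, g) \<in> T)"

definition op_of :: "('h \<Rightarrow> 'h) \<Rightarrow> 'h operator" where
  "op_of F = {(f, F f) | f. True}"

definition op_restrict :: "'h operator \<Rightarrow> 'h set \<Rightarrow> 'h operator" where
  "op_restrict T D = {(f, g). (f, g) \<in> T \<and> f \<in> D}"

definition op_add :: "'h::plus operator \<Rightarrow> 'h operator \<Rightarrow> 'h operator" where
  "op_add T U = {(f, g + h) | f g h. (f, g) \<in> T \<and> (f, h) \<in> U}"

definition densely_defined :: "'h::topological_space operator \<Rightarrow> bool" where
  "densely_defined T \<longleftrightarrow> closure (Domain T) = UNIV"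

definition adj :: "'h::real_inner operator \<Rightarrow> 'h operator" where
  "adj T = {(u, v). \<forall>(f, g) \<in> T. g \<bullet> u = f \<bullet> v}"

definition symmetric_op :: "'h::real_inner operator \<Rightarrow> bool" where
  "symmetric_op T \<longleftrightarrow> (\<forall>f \<in> Domain T. \<forall>g \<in> Domain T. T\<langle>f\<rangle> \<bullet> g = f \<bullet> T\<langle>g\<rangle>)"

definition antisymmetric_op :: "'h::real_inner operator \<Rightarrow> bool" where
  "antisymmetric_op T \<longleftrightarrow> (\<forall>f \<in> Domain T. \<forall>g \<in> Domain T. T\<langle>f\<rangle> \<bullet> g = - (f \<bullet> T\<langle>g\<rangle>))"

definition bounded_op :: "'h::real_normed_vector operator \<Rightarrow> bool" where
  "bounded_op T \<longleftrightarrow> (\<exists>C. \<forall>f \<in> Domain T. norm (T\<langle>f\<rangle>) \<le> C * norm f)"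

definition is_core :: "'h::topological_space operator \<Rightarrow> 'h set \<Rightarrow> bool" where
  "is_core T D \<longleftrightarrow> D \<subseteq> Domain T \<and> closure (op_restrict T D) = T"

definition dissipative :: "'h::real_inner operator \<Rightarrow> bool" where
  "dissipative T \<longleftrightarrow> (\<forall>f \<in> Domain T. T\<langle>f\<rangle> \<bullet> f \<le> 0)"

definition m_dissipative :: "'h::real_inner operator \<Rightarrow> bool" where
  "m_dissipative T \<longleftrightarrow> linear_operator T \<and> dissipative T \<and>
     (\<exists>c > 0. (\<lambda>f. c *\<^sub>R f - T\<langle>f\<rangle>) ` Domain T = UNIV)"

definition essentially_m_dissipative :: "'h::real_inner operator \<Rightarrow> bool" where
  "essentially_m_dissipative T \<longleftrightarrow> dissipative T \<and> m_dissipative (closure T)"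

definition selfadjoint :: "'h::real_inner operator \<Rightarrow> bool" where
  "selfadjoint T \<longleftrightarrow> linear_operator T \<and> densely_defined T \<and> adj T = T"

definition essentially_selfadjoint :: "'h::real_inner operator \<Rightarrow> bool" where
  "essentially_selfadjoint T \<longleftrightarrow> symmetric_op T \<and> selfadjoint (closure T)"

definition orthogonal_projection :: "('h::real_inner \<Rightarrow> 'h) \<Rightarrow> bool" where
  "orthogonal_projection P \<longleftrightarrow>
     bounded_linear P \<and> (\<forall>f. P (P f) = P f) \<and> (\<forall>f g. P f \<bullet> g = f \<bullet> P g)"

definition C0_semigroup :: "(real \<Rightarrow> 'h::real_normed_vector \<Rightarrow> 'h) \<Rightarrow> bool" where
  "C0_semigroup T \<longleftrightarrow>
     (\<forall>t \<ge> 0. bounded_linear (T t)) \<and> T 0 = id \<and>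
     (\<forall>s \<ge> 0. \<forall>t \<ge> 0. T (s + t) = T s \<circ> T t) \<and>
     (\<forall>f. continuous_on {0..} (\<lambda>t. T t f))"

definition generator :: "(real \<Rightarrow> 'h::real_normed_vector \<Rightarrow> 'h) \<Rightarrow> 'h operator" where
  "generator T = {(f, g). ((\<lambda>t. (T t f - f) /\<^sub>R t) \<longlongrightarrow> g) (at_right 0)}"

definition op_AP :: "'h operator \<Rightarrow> ('h \<Rightarrow> 'h) \<Rightarrow> 'h operator" where
  "op_AP A P = op_of P O A"

definition pre_B :: "'h::real_inner operator \<Rightarrow> ('h \<Rightarrow> 'h) \<Rightarrow> 'h operator" where
  "pre_B A P = adj (op_AP A P) O (op_add Id (op_AP A P O adj (op_AP A P)))\<inverse>"

text \<open>
  \<open>pre_B\<close> is \<open>(I + (AP)\<^sup>*AP)\<^sup>-\<^sup>1(AP)\<^sup>*\<close>. For \<open>AP\<close> closed and densely defined its domain is \<open>D((AP)\<^sup>*)\<close>, which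
  is dense, and it is bounded; \<open>op_B\<close> is then its unique continuous linear extension.
\<close>

definition op_B :: "'h::real_inner operator \<Rightarrow> ('h \<Rightarrow> 'h) \<Rightarrow> 'h \<Rightarrow> 'h" where
  "op_B A P = (THE B. bounded_linear B \<and> (\<forall>f \<in> Domain (pre_B A P). B f = (pre_B A P)\<langle>f\<rangle>))"

definition op_BA :: "'h::real_inner operator \<Rightarrow> ('h \<Rightarrow> 'h) \<Rightarrow> 'h operator" where
  "op_BA A P = A O op_of (op_B A P)"

definition op_PAAP :: "'h operator \<Rightarrow> ('h \<Rightarrow> 'h) \<Rightarrow> 'h set \<Rightarrow> 'h operator" where
  "op_PAAP A P D = op_restrict (op_of P O A O A O op_of P) D"

end

theory Submission
  imports Defs
begin

text \<open>
  Write \<open>T = AP\<close>, a closed operator. Everything rests on the description of \<open>B\<close> by orthogonal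
  decomposition. The orthogonal complement of the graph of \<open>T\<close> in \<open>H \<times> H\<close> consists of the pairs
  \<open>(-T\<^sup>*w, w)\<close>, so projecting \<open>(0, u)\<close> to the graph yields, for every \<open>u\<close>, a unique \<open>f \<in> D(T)\<close> with
  \<open>u - Tf \<in> D(T\<^sup>*)\<close> and \<open>T\<^sup>*(u - Tf) = f\<close>. The map \<open>u \<mapsto> f\<close> is linear and contractive. If \<open>u \<in> D(T\<^sup>*)\<close>, the
  equation reads \<open>(I + T\<^sup>*T)f = T\<^sup>*u\<close>; and \<open>D(T\<^sup>*)\<close> is dense because antisymmetry of \<open>A\<close> gives
  \<open>-PA \<subseteq> T\<^sup>*\<close>. Hence \<open>f = Bu\<close> (\<open>op_B_characterisation\<close>): the projection provides the
  invertibility of \<open>I + T\<^sup>*T\<close> on the range of \<open>T\<^sup>*\<close> and the extension of \<open>B\<close> to \<open>H\<close> at once.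

  For \<open>h \<in> D(A)\<close>, \<open>b = BAh\<close> and \<open>f \<in> D\<close> this gives
  \<open>(b, f - PA\<^sup>2Pf) = (b, f) + (Tb, Tf) = (Ah - Tb, Tf) + (Tb, Tf) = (Ah, APf) = -(h, A\<^sup>2Pf)\<close>,
  which is the formula for \<open>(BA)\<^sup>*\<close>.

  Let \<open>C\<close> be the closure of \<open>(PA\<^sup>2P, D)\<close>, which is symmetric and nonpositive. A vector \<open>w\<close> orthogonal to
  \<open>(I - PA\<^sup>2P)(D)\<close> satisfies \<open>C\<^sup>*w = w\<close>. Under either hypothesis on \<open>PA\<^sup>2P\<close> the operator \<open>C\<close> is
  selfadjoint, so \<open>Cw = w\<close> and \<open>\<parallel>w\<parallel>\<^sup>2 = (Cw, w) \<le> 0\<close>. So the vectors \<open>g\<close> on which \<open>(BA)\<^sup>*\<close> is assumed to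
  be bounded are dense, and by duality \<open>\<parallel>BAh\<parallel> \<le> M\<^sub>2\<parallel>h\<parallel>\<close> for every \<open>h \<in> D(A)\<close>. Taking \<open>h = f - Pf\<close>
  gives the estimate with \<open>P\<^sub>2 = P\<close>.
\<close>

section \<open>Orthogonal projection to a closed subspace\<close>

text \<open>
  By the parallelogram law, two points of \<open>V\<close> whose squared distances to \<open>x\<close> exceed the infimum by at
  most \<open>\<epsilon>\<close> are at squared distance at most \<open>4\<epsilon>\<close>. The sets of almost minimisers therefore shrink to a
  point, which is the foot of the perpendicular.
\<close>

lemma closed_subspace_projection:
  fixes x :: "'a::{real_inner, complete_space}"
  assumes V: "subspace V" "closed V"
  obtains p where "p \<in> V" "\<And>v. v \<in> V \<Longrightarrow> (x - p) \<bullet> v = 0"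
proof -
  define d where "d = (INF v\<in>V. (norm (x - v))\<^sup>2)"
  have ne: "V \<noteq> {}" using subspace_0[OF V(1)] by auto
  have bdd: "bdd_below ((\<lambda>v. (norm (x - v))\<^sup>2) ` V)"
    by (rule bdd_belowI2[where m=0]) simp
  have d_le: "d \<le> (norm (x - v))\<^sup>2" if "v \<in> V" for v
    unfolding d_def using bdd that by (rule cINF_lower)
  define F where "F n = {v \<in> V. (norm (x - v))\<^sup>2 \<le> d + 1 / real (Suc n)}" for n
  have "closed (F n)" for n
  proof -
    have "closed {v. (norm (x - v))\<^sup>2 \<le> d + 1 / real (Suc n)}"
      by (intro closed_Collect_le continuous_intros)
    moreover have "F n = V \<inter> {v. (norm (x - v))\<^sup>2 \<le> d + 1 / real (Suc n)}"
      unfolding F_def by auto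
    ultimately show ?thesis using V(2) by auto
  qed
  moreover have "F n \<noteq> {}" for n
  proof -
    have "(INF v\<in>V. (norm (x - v))\<^sup>2) < d + 1 / real (Suc n)"
      unfolding d_def[symmetric] by simp
    then obtain v where "v \<in> V" "(norm (x - v))\<^sup>2 < d + 1 / real (Suc n)"
      using cINF_less_iff[OF ne bdd] by blast
    then show ?thesis unfolding F_def by auto
  qed
  moreover have "F n \<subseteq> F m" if "m \<le> n" for m n
  proof -
    have "1 / real (Suc n) \<le> 1 / real (Suc m)"
      using that by (intro divide_left_mono) auto
    then show ?thesis unfolding F_def by auto
  qed
  moreover have "\<exists>n. \<forall>a\<in>F n. \<forall>b\<in>F n. dist a b < e" if "e > 0" for e
  proof -
    have "0 < e\<^sup>2 / 4" using that by simp
    then obtain n where n: "1 / real (Suc n) < e\<^sup>2 / 4"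
      by (rule nat_approx_posE)
    have "dist a b < e" if ab: "a \<in> F n" "b \<in> F n" for a b
    proof -
      have "(1/2) *\<^sub>R (a + b) \<in> V"
        using ab V(1) unfolding F_def by (auto intro: subspace_add subspace_scale)
      then have mid: "d \<le> (norm (x - (1/2) *\<^sub>R (a + b)))\<^sup>2" by (rule d_le)
      have "(norm (a - b))\<^sup>2
          = 2 * (norm (x - a))\<^sup>2 + 2 * (norm (x - b))\<^sup>2 - 4 * (norm (x - (1/2) *\<^sub>R (a + b)))\<^sup>2"
        by (simp add: power2_norm_eq_inner inner_diff inner_add inner_commute algebra_simps)
      also have "\<dots> \<le> 4 * (1 / real (Suc n))"
        using mid ab unfolding F_def by (simp add: algebra_simps)
      also have "\<dots> < e\<^sup>2" using n by simp
      finally show ?thesis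
        unfolding dist_norm using \<open>e > 0\<close> by (simp add: power2_less_imp_less)
    qed
    then show ?thesis by blast
  qed
  ultimately obtain p where p: "\<And>n. p \<in> F n"
    using decreasing_closed_nest[of F] by metis
  have pV: "p \<in> V" using p[of 0] unfolding F_def by auto
  have "(norm (x - p))\<^sup>2 \<le> d"
  proof (rule field_le_epsilon)
    fix e :: real assume "0 < e"
    then obtain n where "1 / real (Suc n) < e" by (rule nat_approx_posE)
    then show "(norm (x - p))\<^sup>2 \<le> d + e" using p[of n] unfolding F_def by auto
  qed
  then have min: "(norm (x - p))\<^sup>2 \<le> (norm (x - v))\<^sup>2" if "v \<in> V" for v
    using d_le[OF that] by linarith
  have "(x - p) \<bullet> v = 0" if v: "v \<in> V" for v
  proof (cases "v = 0")
    case False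
    then have vv: "v \<bullet> v > 0" by simp
    (* the best approximation of x on the line p + R v *)
    define t where "t = ((x - p) \<bullet> v) / (v \<bullet> v)"
    have "p + t *\<^sub>R v \<in> V" using pV v V(1) by (auto intro: subspace_add subspace_scale)
    from min[OF this] have "2 * t * ((x - p) \<bullet> v) \<le> t * t * (v \<bullet> v)"
      by (simp add: power2_norm_eq_inner inner_diff inner_add inner_commute algebra_simps)
    moreover have "t * (v \<bullet> v) = (x - p) \<bullet> v" using vv unfolding t_def by simp
    ultimately have "t * ((x - p) \<bullet> v) \<le> 0" by (simp add: mult.assoc)
    then have "((x - p) \<bullet> v)\<^sup>2 \<le> 0"
      using vv unfolding t_def by (simp add: power2_eq_square divide_le_0_iff)
    then show ?thesis by simp
  qed simp
  then show thesis using that pV by blast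
qed

lemma subspace_closure:
  fixes V :: "'a::real_normed_vector set"
  assumes "subspace V"
  shows "subspace (closure V)"
proof (rule subspaceI)
  show "0 \<in> closure V" using subspace_0[OF assms] closure_subset by blast
next
  fix x y assume "x \<in> closure V" "y \<in> closure V"
  then obtain a b where "\<And>n. a n \<in> V" "a \<longlonglongrightarrow> x" "\<And>n. b n \<in> V" "b \<longlonglongrightarrow> y"
    unfolding closure_sequential by blast
  then have "\<forall>n. a n + b n \<in> V" "(\<lambda>n. a n + b n) \<longlonglongrightarrow> x + y"
    using assms by (auto intro: subspace_add tendsto_add)
  then show "x + y \<in> closure V"
    unfolding closure_sequential by (intro exI[of _ "\<lambda>n. a n + b n"] conjI)
next
  fix c x assume "x \<in> closure V"
  then obtain a where "\<And>n. a n \<in> V" "a \<longlonglongrightarrow> x" unfolding closure_sequential by blast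
  then have "\<forall>n. c *\<^sub>R a n \<in> V" "(\<lambda>n. c *\<^sub>R a n) \<longlonglongrightarrow> c *\<^sub>R x"
    using assms by (auto intro: subspace_scale tendsto_scaleR)
  then show "c *\<^sub>R x \<in> closure V"
    unfolding closure_sequential by (intro exI[of _ "\<lambda>n. c *\<^sub>R a n"] conjI)
qed

lemma dense_subspace_if_orthogonal_trivial:
  fixes V :: "'a::{real_inner, complete_space} set"
  assumes V: "subspace V" and orth: "\<And>w. (\<And>v. v \<in> V \<Longrightarrow> w \<bullet> v = 0) \<Longrightarrow> w = 0"
  shows "closure V = UNIV"
proof -
  have "x \<in> closure V" for x
  proof -
    obtain p where p: "p \<in> closure V" "\<And>v. v \<in> closure V \<Longrightarrow> (x - p) \<bullet> v = 0"
      using closed_subspace_projection[OF subspace_closure[OF V] closed_closure] by blast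
    then have "x - p = 0" using closure_subset[of V] by (intro orth) auto
    then show ?thesis using p(1) by simp
  qed
  then show ?thesis by auto
qed

section \<open>Operators as graphs\<close>

lemma app_eq:
  assumes "single_valued T" "(f, g) \<in> T"
  shows "T\<langle>f\<rangle> = g"
  unfolding app_def using assms by (auto simp: single_valued_def)

lemma in_graph_app:
  assumes "single_valued T" "f \<in> Domain T"
  shows "(f, T\<langle>f\<rangle>) \<in> T"
  using assms app_eq by (metis Domain.cases)

lemma subspace_op_of:
  assumes "linear F"
  shows "subspace (op_of F)"
  unfolding op_of_def
  by (rule subspaceI)
     (auto simp: zero_prod_def linear_0[OF assms] linear_add[OF assms] linear_scale[OF assms])

lemma subspace_relcomp:
  assumes "subspace R" "subspace S"
  shows "subspace (R O S)"
proof (rule subspaceI)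
  show "0 \<in> R O S"
    using assms[THEN subspace_0] unfolding zero_prod_def by blast
next
  fix x y assume "x \<in> R O S" "y \<in> R O S"
  then obtain a b c a' b' c' where "x = (a, c)" "y = (a', c')"
    "(a, b) \<in> R" "(b, c) \<in> S" "(a', b') \<in> R" "(b', c') \<in> S" by blast
  moreover from this have "(a + a', b + b') \<in> R" "(b + b', c + c') \<in> S"
    using assms[THEN subspace_add] by (metis add_Pair)+
  ultimately show "x + y \<in> R O S" by auto
next
  fix k x assume "x \<in> R O S"
  then obtain a b c where "x = (a, c)" "(a, b) \<in> R" "(b, c) \<in> S" by blast
  moreover from this have "(k *\<^sub>R a, k *\<^sub>R b) \<in> R" "(k *\<^sub>R b, k *\<^sub>R c) \<in> S"
    using assms[THEN subspace_scale] by (metis scaleR_Pair)+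
  ultimately show "k *\<^sub>R x \<in> R O S" by auto
qed

lemma subspace_op_restrict:
  assumes "subspace R" "subspace D"
  shows "subspace (op_restrict R D)"
proof -
  have "op_restrict R D = R \<inter> fst -` D" unfolding op_restrict_def by auto
  then show ?thesis
    using assms by (simp add: subspace_inter linear_subspace_vimage linear_fst)
qed

lemma antisymmetric_op_graphD:
  assumes "antisymmetric_op T" "single_valued T" "(f, g) \<in> T" "(f', g') \<in> T"
  shows "g \<bullet> f' = - (f \<bullet> g')"
  using assms app_eq unfolding antisymmetric_op_def by (metis DomainI)

lemma adjD: "(u, v) \<in> adj T \<Longrightarrow> (f, g) \<in> T \<Longrightarrow> g \<bullet> u = f \<bullet> v"
  unfolding adj_def by auto

lemma subspace_adj: "subspace (adj T)"
  unfolding subspace_def adj_def by (fastforce simp: inner_add_right zero_prod_def)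

lemma single_valued_adj:
  assumes "closure (Domain T) = UNIV"
  shows "single_valued (adj T)"
proof (rule single_valuedI)
  fix u v v' assume uv: "(u, v) \<in> adj T" "(u, v') \<in> adj T"
  have "Domain T \<subseteq> {f. f \<bullet> (v - v') = 0}"
    using adjD[OF uv(1)] adjD[OF uv(2)] by (force simp: inner_diff_right)
  moreover have "closed {f. f \<bullet> (v - v') = 0}"
    by (intro closed_Collect_eq continuous_intros)
  ultimately have "v - v' \<in> {f. f \<bullet> (v - v') = 0}"
    using assms closure_minimal by blast
  then show "v = v'" by simp
qed

text \<open>
  The dual form of boundedness: a bound for \<open>K\<^sup>*\<close> on a dense set is a bound for \<open>K\<close> on its whole
  domain. Cauchy-Schwarz gives \<open>(k, g) \<le> M \<parallel>h\<parallel> \<parallel>g\<parallel>\<close> for \<open>g\<close> in the dense set, hence for \<open>g = k\<close>.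
  If \<open>k = 0\<close>, the claim is \<open>0 \<le> M \<parallel>h\<parallel>\<close>, and this is the limit of the inequalities \<open>0 \<le> M \<parallel>g\<parallel>\<close>.
\<close>

lemma norm_le_if_adj_bounded_on_dense:
  assumes dense: "closure R = UNIV"
    and bound: "\<And>g. g \<in> R \<Longrightarrow> \<exists>v. (g, v) \<in> adj K \<and> norm v \<le> M * norm g"
    and hk: "(h, k) \<in> K"
  shows "norm k \<le> M * norm h"
proof -
  have "R \<subseteq> {g. 0 \<le> M * norm g}"
    using bound norm_ge_zero order_trans by blast
  moreover have "closed {g::'a. 0 \<le> M * norm g}"
    by (intro closed_Collect_le continuous_intros)
  ultimately have "h \<in> {g. 0 \<le> M * norm g}" using dense closure_minimal by blast
  then have nonneg: "0 \<le> M * norm h" by simp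
  have "k \<bullet> g \<le> M * norm h * norm g" if g: "g \<in> R" for g
  proof -
    obtain v where v: "(g, v) \<in> adj K" "norm v \<le> M * norm g" using bound[OF g] by blast
    have "k \<bullet> g = h \<bullet> v" using adjD[OF v(1) hk] .
    also have "\<dots> \<le> norm h * norm v" by (rule norm_cauchy_schwarz)
    also have "\<dots> \<le> norm h * (M * norm g)" using v(2) by (intro mult_left_mono) auto
    finally show ?thesis by (simp add: mult_ac)
  qed
  then have "R \<subseteq> {g. k \<bullet> g \<le> M * norm h * norm g}" by auto
  moreover have "closed {g. k \<bullet> g \<le> M * norm h * norm g}"
    by (intro closed_Collect_le continuous_intros)
  ultimately have "k \<in> {g. k \<bullet> g \<le> M * norm h * norm g}" using dense closure_minimal by blast
  then have "norm k * norm k \<le> M * norm h * norm k"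
    by (simp add: power2_eq_square flip: power2_norm_eq_inner)
  then show ?thesis using nonneg by (cases "k = 0") auto
qed

section \<open>The operator B by decomposition along a graph\<close>

text \<open>
  This is \<open>(0, u) = (f, g) + (-f, u - g)\<close> with the first summand in the graph of \<open>T\<close> and the second
  one orthogonal to it.
\<close>

lemma graph_decomposition_exists:
  fixes T :: "'h::{real_inner, complete_space} operator"
  assumes "subspace T" "closed T"
  shows "\<exists>f g. (f, g) \<in> T \<and> (u - g, f) \<in> adj T"
proof -
  obtain p where p: "p \<in> T" "\<And>v. v \<in> T \<Longrightarrow> ((0, u) - p) \<bullet> v = 0"
    using closed_subspace_projection[OF assms] by blast
  obtain f g where fg: "p = (f, g)" by fastforce
  have "g' \<bullet> (u - g) = f' \<bullet> f" if "(f', g') \<in> T" for f' g'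
    using p(2)[OF that] unfolding fg by (simp add: inner_commute)
  then have "(u - g, f) \<in> adj T" unfolding adj_def by auto
  then show ?thesis using p(1) fg by auto
qed

text \<open>Testing \<open>(u - g, f) \<in> T\<^sup>*\<close> against \<open>(f, g) \<in> T\<close> gives \<open>\<parallel>f\<parallel>\<^sup>2 + \<parallel>g\<parallel>\<^sup>2 = (g, u)\<close>.\<close>

lemma graph_decomposition_contractive:
  assumes "(f, g) \<in> T" "(u - g, f) \<in> adj T"
  shows "norm f \<le> norm u"
proof -
  have "g \<bullet> u = (norm f)\<^sup>2 + (norm g)\<^sup>2"
    using adjD[OF assms(2,1)] by (simp add: inner_diff_right power2_norm_eq_inner)
  moreover have "g \<bullet> u \<le> norm g * norm u" by (rule norm_cauchy_schwarz)
  moreover have "2 * (norm g * norm u) \<le> (norm g)\<^sup>2 + (norm u)\<^sup>2"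
    using sum_squares_bound[of "norm g" "norm u"] by simp
  moreover have "0 \<le> (norm f)\<^sup>2" "0 \<le> (norm g)\<^sup>2" by simp_all
  ultimately have "(norm f)\<^sup>2 \<le> (norm u)\<^sup>2" by linarith
  then show ?thesis by (rule power2_le_imp_le) simp
qed

lemma graph_decomposition_unique:
  assumes T: "subspace T"
    and 1: "(f, g) \<in> T" "(u - g, f) \<in> adj T"
    and 2: "(f', g') \<in> T" "(u - g', f') \<in> adj T"
  shows "f = f'"
proof -
  have "(f - f', g - g') \<in> T" using subspace_diff[OF T 1(1) 2(1)] by simp
  moreover have "(0 - (g - g'), f - f') \<in> adj T"
    using subspace_diff[OF subspace_adj 1(2) 2(2)] by simp
  ultimately have "norm (f - f') \<le> norm (0::'a)" by (rule graph_decomposition_contractive)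
  then show ?thesis by simp
qed

lemma graph_decomposition_map:
  fixes T :: "'h::{real_inner, complete_space} operator"
  assumes T: "subspace T" "closed T"
  obtains B where "bounded_linear B"
    "\<And>u. \<exists>g. (B u, g) \<in> T \<and> (u - g, B u) \<in> adj T"
proof -
  obtain B where B: "\<And>u. \<exists>g. (B u, g) \<in> T \<and> (u - g, B u) \<in> adj T"
    using graph_decomposition_exists[OF T] by metis
  have "bounded_linear B"
  proof (rule bounded_linear_intro[where K=1])
    fix u v
    obtain g where g: "(B u, g) \<in> T" "(u - g, B u) \<in> adj T" using B by blast
    obtain h where h: "(B v, h) \<in> T" "(v - h, B v) \<in> adj T" using B by blast
    obtain k where k: "(B (u + v), k) \<in> T" "(u + v - k, B (u + v)) \<in> adj T" using B by blast
    have "(B u + B v, g + h) \<in> T" using subspace_add[OF T(1) g(1) h(1)] by simp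
    moreover have "(u + v - (g + h), B u + B v) \<in> adj T"
      using subspace_add[OF subspace_adj g(2) h(2)] by (simp add: algebra_simps)
    ultimately show "B (u + v) = B u + B v"
      using graph_decomposition_unique[OF T(1) k] by simp
  next
    fix c u
    obtain g where g: "(B u, g) \<in> T" "(u - g, B u) \<in> adj T" using B by blast
    obtain k where k: "(B (c *\<^sub>R u), k) \<in> T" "(c *\<^sub>R u - k, B (c *\<^sub>R u)) \<in> adj T" using B by blast
    have "(c *\<^sub>R B u, c *\<^sub>R g) \<in> T" using subspace_scale[OF T(1) g(1), of c] by simp
    moreover have "(c *\<^sub>R u - c *\<^sub>R g, c *\<^sub>R B u) \<in> adj T"
      using subspace_scale[OF subspace_adj g(2), of c] by (simp add: algebra_simps)
    ultimately show "B (c *\<^sub>R u) = c *\<^sub>R B u"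
      using graph_decomposition_unique[OF T(1) k] by simp
  next
    fix u
    show "norm (B u) \<le> norm u * 1" using B[of u] graph_decomposition_contractive by fastforce
  qed
  then show thesis using that B by blast
qed

lemma in_op_AP: "(f, g) \<in> op_AP A P \<longleftrightarrow> (P f, g) \<in> A"
  unfolding op_AP_def op_of_def by auto

lemma subspace_op_AP:
  assumes "subspace A" "linear P"
  shows "subspace (op_AP A P)"
  unfolding op_AP_def using assms by (intro subspace_relcomp subspace_op_of)

lemma closed_op_AP:
  assumes "closed A" "bounded_linear P"
  shows "closed (op_AP A P)"
proof -
  have "op_AP A P = (\<lambda>z. (P (fst z), snd z)) -` A" using in_op_AP[of _ _ A P] by auto
  moreover have "continuous_on UNIV (\<lambda>z. (P (fst z), snd z))"
    by (intro continuous_intros bounded_linear.continuous_on[OF assms(2)])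
  ultimately show ?thesis using closed_vimage[OF assms(1)] by metis
qed

text \<open>
  Written out, membership in \<^const>\<open>pre_B\<close> is the decomposition of \<open>(0, u)\<close> along the graph of \<open>AP\<close>
  for those \<open>u\<close> that lie in \<open>D((AP)\<^sup>*)\<close>.
\<close>

lemma in_pre_B:
  "(u, f) \<in> pre_B A P \<longleftrightarrow> u \<in> Domain (adj (op_AP A P)) \<and>
     (\<exists>g. (f, g) \<in> op_AP A P \<and> (u - g, f) \<in> adj (op_AP A P))"
  (is "?l \<longleftrightarrow> ?r")
proof
  assume ?l
  then obtain v g h where v: "(u, v) \<in> adj (op_AP A P)" "v = f + h"
    and g: "(f, g) \<in> op_AP A P" "(g, h) \<in> adj (op_AP A P)"
    unfolding pre_B_def op_add_def by auto
  then show ?r using subspace_diff[OF subspace_adj v(1) g(2)] by auto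
next
  assume ?r
  then obtain v g where v: "(u, v) \<in> adj (op_AP A P)"
    and g: "(f, g) \<in> op_AP A P" "(u - g, f) \<in> adj (op_AP A P)" by auto
  have "(g, v - f) \<in> adj (op_AP A P)" using subspace_diff[OF subspace_adj v g(2)] by simp
  then have "(f, f + (v - f)) \<in> op_add Id (op_AP A P O adj (op_AP A P))"
    unfolding op_add_def using g(1) by blast
  then show ?l unfolding pre_B_def using v by auto
qed

text \<open>
  The decomposition map is linear and bounded and agrees with \<^const>\<open>pre_B\<close> on a dense set, so it is
  the extension that \<^const>\<open>op_B\<close> selects.
\<close>

lemma op_B_characterisation:
  fixes A :: "'h::{real_inner, complete_space} operator"
  assumes A: "subspace A" "closed A" and P: "bounded_linear P"
    and dense: "closure (Domain (adj (op_AP A P))) = UNIV"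
  shows "\<exists>g. (op_B A P u, g) \<in> op_AP A P \<and> (u - g, op_B A P u) \<in> adj (op_AP A P)"
proof -
  have T: "subspace (op_AP A P)" "closed (op_AP A P)"
    using A P by (simp_all add: subspace_op_AP closed_op_AP bounded_linear.linear)
  obtain B where B: "bounded_linear B"
    "\<And>u. \<exists>g. (B u, g) \<in> op_AP A P \<and> (u - g, B u) \<in> adj (op_AP A P)"
    using graph_decomposition_map[OF T] by blast
  have sv: "single_valued (pre_B A P)"
    by (rule single_valuedI) (metis in_pre_B graph_decomposition_unique[OF T(1)])
  have dom: "Domain (pre_B A P) = Domain (adj (op_AP A P))"
    using B(2) in_pre_B[of _ _ A P] by blast
  have ext: "B u = (pre_B A P)\<langle>u\<rangle>" if "u \<in> Domain (pre_B A P)" for u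
  proof -
    have "(u, B u) \<in> pre_B A P" using that B(2)[of u] unfolding dom in_pre_B by blast
    then show ?thesis using app_eq[OF sv] by simp
  qed
  have "op_B A P = B"
    unfolding op_B_def
  proof (rule the_equality)
    fix B' assume B': "bounded_linear B' \<and> (\<forall>f\<in>Domain (pre_B A P). B' f = (pre_B A P)\<langle>f\<rangle>)"
    have "Domain (pre_B A P) \<subseteq> {u. B' u = B u}" using B' ext by (intro subsetI) simp
    moreover have "closed {u. B' u = B u}"
      using B(1) B' by (intro closed_Collect_eq linear_continuous_on) auto
    ultimately have "UNIV \<subseteq> {u. B' u = B u}" using dense closure_minimal unfolding dom by metis
    then show "B' = B" by auto
  qed (use B(1) ext in auto)
  then show ?thesis using B(2) by simp
qed

section \<open>Density of the range of I - C for selfadjoint nonpositive C\<close>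

text \<open>
  If \<open>v\<close> solves \<open>(c - C)v = cw - w'\<close>, where \<open>w' = C\<^sup>*w\<close>, then \<open>w - v\<close> is orthogonal to the range of
  \<open>c - C\<close>, which is everything; so \<open>w = v \<in> D(C)\<close>.
\<close>

lemma adj_subset_if_symmetric_m_dissipative:
  assumes sv: "single_valued C"
    and sym: "\<And>f g f' g'. (f, g) \<in> C \<Longrightarrow> (f', g') \<in> C \<Longrightarrow> g \<bullet> f' = f \<bullet> g'"
    and mdiss: "m_dissipative C"
  shows "adj C \<subseteq> C"
proof
  fix z assume "z \<in> adj C"
  moreover obtain w w' where z: "z = (w, w')" by fastforce
  ultimately have w: "(w, w') \<in> adj C" by simp
  obtain c where surj: "(\<lambda>f. c *\<^sub>R f - C\<langle>f\<rangle>) ` Domain C = UNIV"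
    using mdiss unfolding m_dissipative_def by blast
  have surj': "\<exists>f g. (f, g) \<in> C \<and> c *\<^sub>R f - g = y" for y
  proof -
    have "y \<in> (\<lambda>f. c *\<^sub>R f - C\<langle>f\<rangle>) ` Domain C" using surj by simp
    then show ?thesis using in_graph_app[OF sv] by blast
  qed
  obtain v v' where v: "(v, v') \<in> C" "c *\<^sub>R v - v' = c *\<^sub>R w - w'" using surj' by blast
  obtain f g where f: "(f, g) \<in> C" "c *\<^sub>R f - g = w - v" using surj' by blast
  have "(w - v) \<bullet> (w - v) = (c *\<^sub>R f - g) \<bullet> (w - v)" using f by simp
  also have "\<dots> = c * (f \<bullet> w) - g \<bullet> w - (c * (f \<bullet> v) - g \<bullet> v)"
    by (simp add: inner_diff_left inner_diff_right)
  also have "\<dots> = f \<bullet> (c *\<^sub>R w - w') - f \<bullet> (c *\<^sub>R v - v')"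
    using adjD[OF w f(1)] sym[OF f(1) v(1)] by (simp add: inner_diff_right)
  also have "\<dots> = 0" using v(2) by simp
  finally have wv: "w = v" by simp
  then have "v' = w'" using v(2) by simp
  then show "z \<in> C" using v(1) wv z by simp
qed

lemma closure_graph_symmetric:
  fixes G :: "'h::real_inner operator"
  assumes sym: "\<And>f g f' g'. (f, g) \<in> G \<Longrightarrow> (f', g') \<in> G \<Longrightarrow> g \<bullet> f' = f \<bullet> g'"
    and z: "(f, g) \<in> closure G" "(f', g') \<in> closure G"
  shows "g \<bullet> f' = f \<bullet> g'"
proof -
  have cl: "closed {x::'h \<times> 'h. snd x \<bullet> fst y = fst x \<bullet> snd y}"
       "closed {x::'h \<times> 'h. snd y \<bullet> fst x = fst y \<bullet> snd x}" for y
    by (intro closed_Collect_eq continuous_intros)+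
  have 1: "closure G \<subseteq> {x. snd x \<bullet> fst y = fst x \<bullet> snd y}" if "y \<in> G" for y
    using sym that by (intro closure_minimal cl) (auto simp: prod_eq_iff)
  have "closure G \<subseteq> {x. snd (f, g) \<bullet> fst x = fst (f, g) \<bullet> snd x}"
    using 1 z(1) by (intro closure_minimal cl) fastforce
  then show ?thesis using z(2) by auto
qed

text \<open>
  A vector \<open>w\<close> orthogonal to the range satisfies \<open>(w, w) \<in> C\<^sup>* \<subseteq> C\<close> for the closure \<open>C\<close> of \<open>G\<close>: it is
  an eigenvector of a nonpositive operator for the eigenvalue 1, hence zero.
\<close>

lemma dense_range_I_minus:
  fixes G :: "'h::{real_inner, complete_space} operator"
  assumes lin: "linear_operator G"
    and sym: "\<And>f g f' g'. (f, g) \<in> G \<Longrightarrow> (f', g') \<in> G \<Longrightarrow> g \<bullet> f' = f \<bullet> g'"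
    and nonpos: "\<And>f g. (f, g) \<in> G \<Longrightarrow> g \<bullet> f \<le> 0"
    and ess: "essentially_m_dissipative G \<or> essentially_selfadjoint G"
  shows "closure ((\<lambda>(f, g). f - g) ` G) = UNIV"
proof (rule dense_subspace_if_orthogonal_trivial)
  have "linear (\<lambda>(f, g). f - (g::'h))"
    by (intro linearI) (auto simp: algebra_simps)
  then show "subspace ((\<lambda>(f, g). f - g) ` G)"
    using lin linear_subspace_image unfolding linear_operator_def by blast
next
  fix w assume w: "\<And>v. v \<in> (\<lambda>(f, g). f - g) ` G \<Longrightarrow> w \<bullet> v = 0"
  have "G \<subseteq> {x. snd x \<bullet> w = fst x \<bullet> w}"
    using w by (force simp: inner_diff_right inner_commute)
  moreover have "closed {x::'h \<times> 'h. snd x \<bullet> w = fst x \<bullet> w}"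
    by (intro closed_Collect_eq continuous_intros)
  ultimately have "closure G \<subseteq> {x. snd x \<bullet> w = fst x \<bullet> w}" by (rule closure_minimal)
  then have w_adj: "(w, w) \<in> adj (closure G)" unfolding adj_def by auto
  have "adj (closure G) \<subseteq> closure G"
    using ess
  proof
    assume "essentially_m_dissipative G"
    then have md: "m_dissipative (closure G)" unfolding essentially_m_dissipative_def by simp
    then have "single_valued (closure G)" unfolding m_dissipative_def linear_operator_def by simp
    then show ?thesis
      using closure_graph_symmetric[OF sym] md by (rule adj_subset_if_symmetric_m_dissipative)
  qed (simp add: essentially_selfadjoint_def selfadjoint_def)
  with w_adj have "(w, w) \<in> closure G" by blast
  moreover have "closure G \<subseteq> {x. snd x \<bullet> fst x \<le> 0}"
    using nonpos by (intro closure_minimal closed_Collect_le continuous_intros) auto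
  ultimately have "w \<bullet> w \<le> 0" by auto
  then show "w = 0" by (metis inner_ge_zero inner_eq_zero_iff order_antisym)
qed

section \<open>The adjoint of BA\<close>

theorem proposition2p15:
  fixes M :: "'e measure"
    and cls :: "('e \<Rightarrow> real) \<Rightarrow> 'h::{real_inner, complete_space}"
    and T :: "real \<Rightarrow> 'h \<Rightarrow> 'h"
    and L S A :: "'h operator"
    and D :: "'h set"
    and P P\<^sub>S :: "'h \<Rightarrow> 'h"
    and one :: 'h
  assumes D1: "prob_space M" "is_L2 M cls"
    and one: "one = cls (\<lambda>x. 1)"
    and D2: "linear_operator L" "C0_semigroup T" "L = generator T"
    and D3: "subspace D" "closure D = UNIV" "is_core L D"
    and D4: "linear_operator S" "symmetric_op S"
      "linear_operator A" "closed A" "antisymmetric_op A"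
      "D \<subseteq> Domain S \<inter> Domain A"
      "\<forall>f \<in> D. L\<langle>f\<rangle> = S\<langle>f\<rangle> - A\<langle>f\<rangle>"
    and D5: "orthogonal_projection P"
      "range P \<subseteq> Domain S" "\<forall>f. S\<langle>P f\<rangle> = 0"
      "P ` D \<subseteq> Domain A" "(\<lambda>f. A\<langle>P f\<rangle>) ` D \<subseteq> Domain A"
      "\<forall>f. P\<^sub>S f = P f + (f \<bullet> one) *\<^sub>R one"
    and D6: "\<forall>f \<in> D. L\<langle>f\<rangle> \<bullet> one = 0"
    and D7: "one \<in> Domain L" "L\<langle>one\<rangle> = 0"
  shows "(\<forall>f \<in> D. f - (op_PAAP A P D)\<langle>f\<rangle> \<in> Domain (adj (op_BA A P)) \<and>
            (adj (op_BA A P))\<langle>f - (op_PAAP A P D)\<langle>f\<rangle>\<rangle> = - A\<langle>A\<langle>P f\<rangle>\<rangle>) \<and>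
         (\<forall>M\<^sub>2::real.
            (essentially_m_dissipative (op_PAAP A P D) \<or> essentially_selfadjoint (op_PAAP A P D)) \<longrightarrow>
            (\<forall>f \<in> D. norm ((adj (op_BA A P))\<langle>f - (op_PAAP A P D)\<langle>f\<rangle>\<rangle>)
               \<le> M\<^sub>2 * norm (f - (op_PAAP A P D)\<langle>f\<rangle>)) \<longrightarrow>
            bounded_op (op_restrict (op_of (\<lambda>f. f - P f) O op_BA A P) D) \<and>
            (\<exists>P\<^sub>2 \<in> {P, P\<^sub>S}. \<forall>f \<in> D. norm ((op_BA A P)\<langle>f - P f\<rangle>) \<le> M\<^sub>2 * norm (f - P\<^sub>2 f)))"
proof -
  have P: "bounded_linear P" and Psym: "\<And>f g. P f \<bullet> g = f \<bullet> P g"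
    using D5(1) unfolding orthogonal_projection_def by auto
  have subA: "subspace A" and svA: "single_valued A" using D4(3) unfolding linear_operator_def by auto
  note A_anti = antisymmetric_op_graphD[OF D4(5) svA]
  let ?T = "op_AP A P" and ?G = "op_PAAP A P D" and ?K = "op_BA A P"
  let ?B = "op_B A P"

  have domA: "closure (Domain A) = UNIV"
    using D3(2) D4(6) closure_mono[of D "Domain A"] by auto
  have "Domain A \<subseteq> Domain (adj ?T)"
  proof
    fix u assume "u \<in> Domain A"
    then have u: "(u, A\<langle>u\<rangle>) \<in> A" using in_graph_app[OF svA] by simp
    (* -PA is contained in the adjoint of AP *)
    have "(u, - P (A\<langle>u\<rangle>)) \<in> adj ?T"
      unfolding adj_def using A_anti[OF _ u] by (auto simp: in_op_AP Psym)
    then show "u \<in> Domain (adj ?T)" by auto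
  qed
  then have "closure (Domain (adj ?T)) = UNIV" using domA closure_mono by blast
  note B = op_B_characterisation[OF subA D4(4) P this]

  have AP: "(P f, A\<langle>P f\<rangle>) \<in> A" and AAP: "(A\<langle>P f\<rangle>, A\<langle>A\<langle>P f\<rangle>\<rangle>) \<in> A" if "f \<in> D" for f
    using that D5(4,5) in_graph_app[OF svA] by auto
  have in_G: "(f, g) \<in> ?G \<longleftrightarrow> f \<in> D \<and> g = P (A\<langle>A\<langle>P f\<rangle>\<rangle>)" for f g
  proof
    assume "(f, g) \<in> ?G"
    then obtain a b where "f \<in> D" "(P f, a) \<in> A" "(a, b) \<in> A" "g = P b"
      unfolding op_PAAP_def op_restrict_def op_of_def by auto
    then show "f \<in> D \<and> g = P (A\<langle>A\<langle>P f\<rangle>\<rangle>)" using app_eq[OF svA] by auto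
  next
    assume "f \<in> D \<and> g = P (A\<langle>A\<langle>P f\<rangle>\<rangle>)"
    then show "(f, g) \<in> ?G"
      using AP[of f] AAP[of f] unfolding op_PAAP_def op_restrict_def op_of_def by blast
  qed
  have svG: "single_valued ?G" by (rule single_valuedI) (simp add: in_G)
  have G_app: "?G\<langle>f\<rangle> = P (A\<langle>A\<langle>P f\<rangle>\<rangle>)" if "f \<in> D" for f
    using app_eq[OF svG] in_G that by blast
  have in_K: "(h, k) \<in> ?K \<longleftrightarrow> (\<exists>a. (h, a) \<in> A \<and> k = ?B a)" for h k
    unfolding op_BA_def op_of_def by auto
  have svK: "single_valued ?K"
    by (rule single_valuedI) (use svA in \<open>auto simp: in_K single_valued_def\<close>)
  have "Domain ?K = Domain A" using in_K by blast
  then have sv_adjK: "single_valued (adj ?K)" using single_valued_adj domA by metis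

  have adjK: "(f - ?G\<langle>f\<rangle>, - A\<langle>A\<langle>P f\<rangle>\<rangle>) \<in> adj ?K" if f: "f \<in> D" for f
  proof -
    have "k \<bullet> (f - ?G\<langle>f\<rangle>) = h \<bullet> (- A\<langle>A\<langle>P f\<rangle>\<rangle>)" if hk: "(h, k) \<in> ?K" for h k
    proof -
      obtain a where a: "(h, a) \<in> A" "k = ?B a" using hk unfolding in_K by auto
      obtain t where t: "(P k, t) \<in> A" "(a - t, k) \<in> adj ?T"
        using B[of a] unfolding a(2)[symmetric] in_op_AP by blast
      (* here a = Ah, k = Ba and t = APk *)
      have "k \<bullet> P (A\<langle>A\<langle>P f\<rangle>\<rangle>) = - (t \<bullet> A\<langle>P f\<rangle>)"
        using A_anti[OF t(1) AAP[OF f]] Psym[of k] by simp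
      moreover have "k \<bullet> f = (a - t) \<bullet> A\<langle>P f\<rangle>"
        using adjD[OF t(2), of f "A\<langle>P f\<rangle>"] AP[OF f] by (simp add: in_op_AP inner_commute)
      moreover have "a \<bullet> A\<langle>P f\<rangle> = - (h \<bullet> A\<langle>A\<langle>P f\<rangle>\<rangle>)" using A_anti[OF a(1) AAP[OF f]] .
      ultimately show ?thesis
        by (simp add: G_app[OF f] inner_diff_right inner_diff_left)
    qed
    then show ?thesis unfolding adj_def by auto
  qed
  have adjK_app: "(adj ?K)\<langle>f - ?G\<langle>f\<rangle>\<rangle> = - A\<langle>A\<langle>P f\<rangle>\<rangle>" if "f \<in> D" for f
    using app_eq[OF sv_adjK adjK[OF that]] .

  have "bounded_op (op_restrict (op_of (\<lambda>f. f - P f) O ?K) D) \<and>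
      (\<exists>P\<^sub>2 \<in> {P, P\<^sub>S}. \<forall>f \<in> D. norm (?K\<langle>f - P f\<rangle>) \<le> M\<^sub>2 * norm (f - P\<^sub>2 f))"
    if ess: "essentially_m_dissipative ?G \<or> essentially_selfadjoint ?G"
      and bound: "\<forall>f \<in> D. norm ((adj ?K)\<langle>f - ?G\<langle>f\<rangle>\<rangle>) \<le> M\<^sub>2 * norm (f - ?G\<langle>f\<rangle>)"
    for M\<^sub>2 :: real
  proof -
    have inner_G: "P (A\<langle>A\<langle>P f\<rangle>\<rangle>) \<bullet> f' = - (A\<langle>P f\<rangle> \<bullet> A\<langle>P f'\<rangle>)" if "f \<in> D" "f' \<in> D" for f f'
      using A_anti[OF AAP[OF that(1)] AP[OF that(2)]] Psym by simp
    have "subspace ?G"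
      unfolding op_PAAP_def using subA D3(1) bounded_linear.linear[OF P]
      by (intro subspace_op_restrict subspace_relcomp subspace_op_of)
    then have "linear_operator ?G" using svG unfolding linear_operator_def by simp
    then have dense: "closure ((\<lambda>(f, g). f - g) ` ?G) = UNIV"
    proof (rule dense_range_I_minus)
      fix f g f' g' assume "(f, g) \<in> ?G" "(f', g') \<in> ?G"
      then have *: "f \<in> D" "f' \<in> D" "g = P (A\<langle>A\<langle>P f\<rangle>\<rangle>)" "g' = P (A\<langle>A\<langle>P f'\<rangle>\<rangle>)"
        by (simp_all add: in_G)
      show "g \<bullet> f' = f \<bullet> g'"
        using inner_G[OF *(1,2)] inner_G[OF *(2,1)] *(3,4) by (metis inner_commute)
    qed (use ess in \<open>auto simp: in_G inner_G\<close>)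
    have key: "norm k \<le> M\<^sub>2 * norm h" if "(h, k) \<in> ?K" for h k
      using dense
    proof (rule norm_le_if_adj_bounded_on_dense)
      fix g assume "g \<in> (\<lambda>(f, g). f - g) ` ?G"
      then obtain f where f: "f \<in> D" "g = f - ?G\<langle>f\<rangle>" using in_G G_app by auto
      then show "\<exists>v. (g, v) \<in> adj ?K \<and> norm v \<le> M\<^sub>2 * norm g"
        using adjK[OF f(1)] bound adjK_app[OF f(1)] by metis
    qed (rule that)
    have domK: "(f - P f, ?K\<langle>f - P f\<rangle>) \<in> ?K" if "f \<in> D" for f
    proof -
      have "(f, A\<langle>f\<rangle>) \<in> A" using that D4(6) by (intro in_graph_app[OF svA]) auto
      then have "(f - P f, A\<langle>f\<rangle> - A\<langle>P f\<rangle>) \<in> A"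
        using subspace_diff[OF subA _ AP[OF that]] by fastforce
      then have "f - P f \<in> Domain ?K" using in_K by blast
      then show ?thesis by (rule in_graph_app[OF svK])
    qed
    have "bounded_op (op_restrict (op_of (\<lambda>f. f - P f) O ?K) D)"
    proof -
      let ?R = "op_restrict (op_of (\<lambda>f. f - P f) O ?K) D"
      have in_R: "(f, k) \<in> ?R \<longleftrightarrow> f \<in> D \<and> (f - P f, k) \<in> ?K" for f k
        unfolding op_restrict_def op_of_def by auto
      have svR: "single_valued ?R"
        using svK unfolding single_valued_def in_R by blast
      have "bounded_linear (\<lambda>f. f - P f)"
        by (intro bounded_linear_sub bounded_linear_ident P)
      then obtain C where C: "\<And>f. norm (f - P f) \<le> norm f * C"
        using bounded_linear.bounded by blast
      have "norm (?R\<langle>f\<rangle>) \<le> \<bar>M\<^sub>2\<bar> * C * norm f" if "f \<in> Domain ?R" for f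
      proof -
        have "(f, ?R\<langle>f\<rangle>) \<in> ?R" using in_graph_app[OF svR that] .
        then have "norm (?R\<langle>f\<rangle>) \<le> M\<^sub>2 * norm (f - P f)" using in_R key by blast
        also have "\<dots> \<le> \<bar>M\<^sub>2\<bar> * norm (f - P f)" by (intro mult_right_mono) auto
        also have "\<dots> \<le> \<bar>M\<^sub>2\<bar> * (norm f * C)" by (intro mult_left_mono C) auto
        finally show ?thesis by (simp add: mult_ac)
      qed
      then show ?thesis unfolding bounded_op_def by blast
    qed
    then show ?thesis using key[OF domK] by blast
  qed
  then show ?thesis using adjK adjK_app by blast
qed

end
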